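(* Let $(\mathcal{A},\mathcal{E})$ be an AIS-category and let $X$ be a finite object of $\mathcal{A}$. Any two $\mathcal{E}$-composition series $$0=X_0\rightarrowtail X_1\rightarrowtail\cdots\rightarrowtail X_{m-1}\rightarrowtail X_m=X$$ and $$0=X'_0\rightarrowtail X'_1\rightarrowtail\cdots\rightarrowtail X'_{n-1}\rightarrowtail X'_n=X$$ of $X$ are equivalent, that is, they have the same length and the same composition factors up to permutation and isomorphism: $m=n$ and there is a permutation $\sigma$ of $\{0,1,\dots,m-1\}$ such that $X'_{l+1}/X'_l\cong X_{\sigma(l)+1}/X_{\sigma(l)}$ for all $0\le l\le m-1$.
   Context: In an exact category $(\mathcal{A},\mathcal{E})$ (additive category with a Quillen exact structure), for $(i,d)\in\mathcal{E}$ the morphism $i$ is called an admissible monic ($\rightarrowtail$) and $d$ an admissible epic. For an admissible monic $i:A\to B$, $B/A$ denotes the cokernel of $i$. An $\mathcal{E}$-subobject of $B$ is an object $A$ together with an admissible monic $A\to B$. A non-zero object $S$ is $\mathcal{E}$-simple if it admits no $\mathcal{E}$-subobjects except $0$ and $S$, that is, for every admissible monic $A\rightarrowtail S$, either $A$ is the zero object or $A$ is isomorphic to $S$ (understood as: the monic $A\rightarrowtail S$ is an isomorphism). An $\mathcal{E}$-composition series of $X$ is a finite sequence $0=X_0\rightarrowtail X_1\rightarrowtail\cdots\rightarrowtail X_n=X$ of admissible monics, none of which is an isomorphism, each having $\mathcal{E}$-simple cokernel; its length is $n$ and its composition factors are the cokernels $X_{l+1}/X_l$. A finite object is an object admitting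 an $\mathcal{E}$-composition series. An exact category $(\mathcal{A},\mathcal{E})$ is an AIS-category if it satisfies the axiom (AIS): for any two admissible monics $j:C\to D$ and $g:B\to D$, their pull-back $A$ exists and yields two admissible monics $i:A\to B$ and $f:A\to C$ (with $g\circ i=j\circ f$); and moreover, if $E$ is the push-out of $i$ and $f$, with morphisms $l:B\to E$ and $k:C\to E$, then the unique morphism $u:E\to D$ with $u\circ l=g$ and $u\circ k=j$ is an admissible monic. *)

theory Defs
  imports "HOL-Combinatorics.Permutations" "HOL-Algebra.Group"
begin

section \<open>Categories\<close>

text \<open>
  Composition is written in applicative order: \<open>g \<cdot> f\<close> is ``\<open>g\<close> after \<open>f\<close>'', and it is
  constrained by the axioms only when \<open>Cod f = Dom g\<close>.
\<close>

record ('o, 'm) cat =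
  Obj :: "'o set"
  Arr :: "'m set"
  Dom :: "'m \<Rightarrow> 'o"
  Cod :: "'m \<Rightarrow> 'o"
  Id :: "'o \<Rightarrow> 'm"
  Comp :: "'m \<Rightarrow> 'm \<Rightarrow> 'm" (infixl \<open>\<cdot>\<index>\<close> 70)

definition Hom :: "('o, 'm, 'z) cat_scheme \<Rightarrow> 'o \<Rightarrow> 'o \<Rightarrow> 'm set" where
  "Hom C A B = {f \<in> Arr C. Dom C f = A \<and> Cod C f = B}"

locale category =
  fixes C :: "('o, 'm, 'z) cat_scheme" (structure)
  assumes Dom_in_Obj: "f \<in> Arr C \<Longrightarrow> Dom C f \<in> Obj C"
    and Cod_in_Obj: "f \<in> Arr C \<Longrightarrow> Cod C f \<in> Obj C"
    and Id_in_Hom: "A \<in> Obj C \<Longrightarrow> Id C A \<in> Hom C A A"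
    and Comp_in_Hom: "\<lbrakk>f \<in> Hom C A B; g \<in> Hom C B D\<rbrakk> \<Longrightarrow> g \<cdot> f \<in> Hom C A D"
    and Comp_Id: "f \<in> Hom C A B \<Longrightarrow> f \<cdot> Id C A = f"
    and Id_Comp: "f \<in> Hom C A B \<Longrightarrow> Id C B \<cdot> f = f"
    and Comp_assoc: "\<lbrakk>f \<in> Hom C A B; g \<in> Hom C B D; h \<in> Hom C D F\<rbrakk>
      \<Longrightarrow> (h \<cdot> g) \<cdot> f = h \<cdot> (g \<cdot> f)"

definition iso_arr :: "('o, 'm, 'z) cat_scheme \<Rightarrow> 'm \<Rightarrow> bool" where
  "iso_arr C f \<longleftrightarrow> f \<in> Arr C \<and>
     (\<exists>g \<in> Hom C (Cod C f) (Dom C f).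
        g \<cdot>\<^bsub>C\<^esub> f = Id C (Dom C f) \<and> f \<cdot>\<^bsub>C\<^esub> g = Id C (Cod C f))"

definition isomorphic :: "('o, 'm, 'z) cat_scheme \<Rightarrow> 'o \<Rightarrow> 'o \<Rightarrow> bool" where
  "isomorphic C A B \<longleftrightarrow> (\<exists>f \<in> Hom C A B. iso_arr C f)"

definition zero_object :: "('o, 'm, 'z) cat_scheme \<Rightarrow> 'o \<Rightarrow> bool" where
  "zero_object C Z \<longleftrightarrow> Z \<in> Obj C \<and>
     (\<forall>A \<in> Obj C. (\<exists>!f. f \<in> Hom C Z A) \<and> (\<exists>!f. f \<in> Hom C A Z))"

text \<open>\<open>is_pullback C g j i f\<close>: the arrows \<open>i : A \<rightarrow> B\<close> and \<open>f : A \<rightarrow> C\<close> form a pull-back of the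
  cospan \<open>g : B \<rightarrow> D\<close>, \<open>j : C \<rightarrow> D\<close>, where \<open>g i = j f\<close>.\<close>

definition is_pullback :: "('o, 'm, 'z) cat_scheme \<Rightarrow> 'm \<Rightarrow> 'm \<Rightarrow> 'm \<Rightarrow> 'm \<Rightarrow> bool" where
  "is_pullback C g j i f \<longleftrightarrow>
     g \<in> Arr C \<and> j \<in> Arr C \<and> i \<in> Arr C \<and> f \<in> Arr C \<and>
     Cod C g = Cod C j \<and> Dom C i = Dom C f \<and> Cod C i = Dom C g \<and> Cod C f = Dom C j \<and>
     g \<cdot>\<^bsub>C\<^esub> i = j \<cdot>\<^bsub>C\<^esub> f \<and>
     (\<forall>T \<in> Obj C. \<forall>p \<in> Hom C T (Dom C g). \<forall>q \<in> Hom C T (Dom C j).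
        g \<cdot>\<^bsub>C\<^esub> p = j \<cdot>\<^bsub>C\<^esub> q \<longrightarrow>
        (\<exists>!u. u \<in> Hom C T (Dom C i) \<and> i \<cdot>\<^bsub>C\<^esub> u = p \<and> f \<cdot>\<^bsub>C\<^esub> u = q))"

text \<open>\<open>is_pushout C i f l k\<close>: the arrows \<open>l : B \<rightarrow> E\<close> and \<open>k : C \<rightarrow> E\<close> form a push-out of the
  span \<open>i : A \<rightarrow> B\<close>, \<open>f : A \<rightarrow> C\<close>, where \<open>l i = k f\<close>.\<close>

definition is_pushout :: "('o, 'm, 'z) cat_scheme \<Rightarrow> 'm \<Rightarrow> 'm \<Rightarrow> 'm \<Rightarrow> 'm \<Rightarrow> bool" where
  "is_pushout C i f l k \<longleftrightarrow>
     i \<in> Arr C \<and> f \<in> Arr C \<and> l \<in> Arr C \<and> k \<in> Arr C \<and>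
     Dom C i = Dom C f \<and> Cod C l = Cod C k \<and> Dom C l = Cod C i \<and> Dom C k = Cod C f \<and>
     l \<cdot>\<^bsub>C\<^esub> i = k \<cdot>\<^bsub>C\<^esub> f \<and>
     (\<forall>T \<in> Obj C. \<forall>p \<in> Hom C (Cod C i) T. \<forall>q \<in> Hom C (Cod C f) T.
        p \<cdot>\<^bsub>C\<^esub> i = q \<cdot>\<^bsub>C\<^esub> f \<longrightarrow>
        (\<exists>!u. u \<in> Hom C (Cod C l) T \<and> u \<cdot>\<^bsub>C\<^esub> l = p \<and> u \<cdot>\<^bsub>C\<^esub> k = q))"


section \<open>Additive categories\<close>

record ('o, 'm) add_cat = "('o, 'm) cat" +
  Plus :: "'m \<Rightarrow> 'm \<Rightarrow> 'm" (infixl \<open>\<boxplus>\<index>\<close> 65)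
  Zero :: "'o \<Rightarrow> 'o \<Rightarrow> 'm"

definition hom_group :: "('o, 'm, 'z) add_cat_scheme \<Rightarrow> 'o \<Rightarrow> 'o \<Rightarrow> 'm monoid" where
  "hom_group C A B = \<lparr>carrier = Hom C A B, monoid.mult = Plus C, one = Zero C A B\<rparr>"

definition is_biproduct ::
    "('o, 'm, 'z) add_cat_scheme \<Rightarrow> 'o \<Rightarrow> 'o \<Rightarrow> 'o \<Rightarrow> 'm \<Rightarrow> 'm \<Rightarrow> 'm \<Rightarrow> 'm \<Rightarrow> bool" where
  "is_biproduct C A B P i\<^sub>1 i\<^sub>2 p\<^sub>1 p\<^sub>2 \<longleftrightarrow>
     i\<^sub>1 \<in> Hom C A P \<and> i\<^sub>2 \<in> Hom C B P \<and> p\<^sub>1 \<in> Hom C P A \<and> p\<^sub>2 \<in> Hom C P B \<and>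
     p\<^sub>1 \<cdot>\<^bsub>C\<^esub> i\<^sub>1 = Id C A \<and> p\<^sub>2 \<cdot>\<^bsub>C\<^esub> i\<^sub>2 = Id C B \<and>
     p\<^sub>2 \<cdot>\<^bsub>C\<^esub> i\<^sub>1 = Zero C A B \<and> p\<^sub>1 \<cdot>\<^bsub>C\<^esub> i\<^sub>2 = Zero C B A \<and>
     (i\<^sub>1 \<cdot>\<^bsub>C\<^esub> p\<^sub>1) \<boxplus>\<^bsub>C\<^esub> (i\<^sub>2 \<cdot>\<^bsub>C\<^esub> p\<^sub>2) = Id C P"

locale additive_category = category C
  for C :: "('o, 'm, 'z) add_cat_scheme" (structure) +
  assumes hom_comm_group: "\<lbrakk>A \<in> Obj C; B \<in> Obj C\<rbrakk> \<Longrightarrow> comm_group (hom_group C A B)"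
    and Comp_Plus_left: "\<lbrakk>f \<in> Hom C A B; g \<in> Hom C B D; g' \<in> Hom C B D\<rbrakk>
      \<Longrightarrow> (g \<boxplus> g') \<cdot> f = (g \<cdot> f) \<boxplus> (g' \<cdot> f)"
    and Comp_Plus_right: "\<lbrakk>f \<in> Hom C A B; f' \<in> Hom C A B; g \<in> Hom C B D\<rbrakk>
      \<Longrightarrow> g \<cdot> (f \<boxplus> f') = (g \<cdot> f) \<boxplus> (g \<cdot> f')"
    and zero_object_exists: "\<exists>Z. zero_object C Z"
    and biproduct_exists: "\<lbrakk>A \<in> Obj C; B \<in> Obj C\<rbrakk>
      \<Longrightarrow> \<exists>P i\<^sub>1 i\<^sub>2 p\<^sub>1 p\<^sub>2. is_biproduct C A B P i\<^sub>1 i\<^sub>2 p\<^sub>1 p\<^sub>2"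

definition is_kernel :: "('o, 'm, 'z) add_cat_scheme \<Rightarrow> 'm \<Rightarrow> 'm \<Rightarrow> bool" where
  "is_kernel C d i \<longleftrightarrow> d \<in> Arr C \<and> i \<in> Arr C \<and> Cod C i = Dom C d \<and>
     d \<cdot>\<^bsub>C\<^esub> i = Zero C (Dom C i) (Cod C d) \<and>
     (\<forall>T \<in> Obj C. \<forall>h \<in> Hom C T (Dom C d). d \<cdot>\<^bsub>C\<^esub> h = Zero C T (Cod C d) \<longrightarrow>
        (\<exists>!u. u \<in> Hom C T (Dom C i) \<and> i \<cdot>\<^bsub>C\<^esub> u = h))"

definition is_cokernel :: "('o, 'm, 'z) add_cat_scheme \<Rightarrow> 'm \<Rightarrow> 'm \<Rightarrow> bool" where
  "is_cokernel C i d \<longleftrightarrow> i \<in> Arr C \<and> d \<in> Arr C \<and> Cod C i = Dom C d \<and>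
     d \<cdot>\<^bsub>C\<^esub> i = Zero C (Dom C i) (Cod C d) \<and>
     (\<forall>T \<in> Obj C. \<forall>h \<in> Hom C (Cod C i) T. h \<cdot>\<^bsub>C\<^esub> i = Zero C (Dom C i) T \<longrightarrow>
        (\<exists>!u. u \<in> Hom C (Cod C d) T \<and> u \<cdot>\<^bsub>C\<^esub> d = h))"

text \<open>\<open>cokernel_object C i Q\<close> says that \<open>Q\<close> is \<open>B/A\<close> for \<open>i : A \<rightarrow> B\<close>.  As \<open>B/A\<close> is determined
  only up to isomorphism, this is a predicate, so that no particular cokernel is chosen.\<close>

definition cokernel_object :: "('o, 'm, 'z) add_cat_scheme \<Rightarrow> 'm \<Rightarrow> 'o \<Rightarrow> bool" where
  "cokernel_object C i Q \<longleftrightarrow> (\<exists>d. is_cokernel C i d \<and> Cod C d = Q)"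

definition kernel_cokernel_pair :: "('o, 'm, 'z) add_cat_scheme \<Rightarrow> 'm \<Rightarrow> 'm \<Rightarrow> bool" where
  "kernel_cokernel_pair C i d \<longleftrightarrow> is_kernel C d i \<and> is_cokernel C i d"


section \<open>Exact categories\<close>

definition admissible_monic :: "('m \<times> 'm) set \<Rightarrow> 'm \<Rightarrow> bool" where
  "admissible_monic E i \<longleftrightarrow> (\<exists>d. (i, d) \<in> E)"

definition admissible_epic :: "('m \<times> 'm) set \<Rightarrow> 'm \<Rightarrow> bool" where
  "admissible_epic E d \<longleftrightarrow> (\<exists>i. (i, d) \<in> E)"

text \<open>An isomorphism of pairs of composable arrows consists of isomorphisms \<open>a\<close>, \<open>b\<close>, \<open>c\<close> making
  the two squares commute.\<close>

definition pair_isomorphic ::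
    "('o, 'm, 'z) cat_scheme \<Rightarrow> 'm \<Rightarrow> 'm \<Rightarrow> 'm \<Rightarrow> 'm \<Rightarrow> bool" where
  "pair_isomorphic C i d i' d' \<longleftrightarrow>
     (\<exists>a \<in> Hom C (Dom C i) (Dom C i'). \<exists>b \<in> Hom C (Cod C i) (Cod C i').
      \<exists>c \<in> Hom C (Cod C d) (Cod C d').
        iso_arr C a \<and> iso_arr C b \<and> iso_arr C c \<and>
        b \<cdot>\<^bsub>C\<^esub> i = i' \<cdot>\<^bsub>C\<^esub> a \<and> c \<cdot>\<^bsub>C\<^esub> d = d' \<cdot>\<^bsub>C\<^esub> b)"

text \<open>Quillen's axioms in the self-dual form used by Keller and Buehler.\<close>

locale exact_category = additive_category C
  for C :: "('o, 'm, 'z) add_cat_scheme" (structure) and E :: "('m \<times> 'm) set" +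
  assumes E_pairs: "(i, d) \<in> E \<Longrightarrow> kernel_cokernel_pair C i d"
    and E_iso_closed: "\<lbrakk>(i, d) \<in> E; kernel_cokernel_pair C i' d'; pair_isomorphic C i d i' d'\<rbrakk>
      \<Longrightarrow> (i', d') \<in> E"
    and Id_admissible_monic: "A \<in> Obj C \<Longrightarrow> admissible_monic E (Id C A)"
    and Id_admissible_epic: "A \<in> Obj C \<Longrightarrow> admissible_epic E (Id C A)"
    and admissible_monic_Comp: "\<lbrakk>admissible_monic E f; admissible_monic E g; Cod C f = Dom C g\<rbrakk>
      \<Longrightarrow> admissible_monic E (g \<cdot> f)"
    and admissible_epic_Comp: "\<lbrakk>admissible_epic E f; admissible_epic E g; Cod C f = Dom C g\<rbrakk>
      \<Longrightarrow> admissible_epic E (g \<cdot> f)"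
    and admissible_monic_pushout:
      "\<lbrakk>admissible_monic E i; f \<in> Arr C; Dom C f = Dom C i\<rbrakk>
        \<Longrightarrow> \<exists>l k. is_pushout C i f l k \<and> admissible_monic E k"
    and admissible_epic_pullback:
      "\<lbrakk>admissible_epic E d; g \<in> Arr C; Cod C g = Cod C d\<rbrakk>
        \<Longrightarrow> \<exists>p q. is_pullback C d g p q \<and> admissible_epic E q"

locale AIS_category = exact_category C E
  for C :: "('o, 'm, 'z) add_cat_scheme" (structure) and E :: "('m \<times> 'm) set" +
  assumes AIS: "\<lbrakk>admissible_monic E j; admissible_monic E g; Cod C j = Cod C g\<rbrakk>
      \<Longrightarrow> \<exists>i f. is_pullback C g j i f \<and> admissible_monic E i \<and> admissible_monic E f \<and>
            (\<forall>l k u. is_pushout C i f l k \<longrightarrow> u \<in> Hom C (Cod C l) (Cod C g) \<longrightarrow>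
               u \<cdot> l = g \<longrightarrow> u \<cdot> k = j \<longrightarrow> admissible_monic E u)"


section \<open>Composition series\<close>

definition E_simple :: "('o, 'm, 'z) add_cat_scheme \<Rightarrow> ('m \<times> 'm) set \<Rightarrow> 'o \<Rightarrow> bool" where
  "E_simple C E S \<longleftrightarrow> S \<in> Obj C \<and> \<not> zero_object C S \<and>
     (\<forall>i. admissible_monic E i \<and> Cod C i = S \<longrightarrow> zero_object C (Dom C i) \<or> iso_arr C i)"

text \<open>\<open>composition_series C E X n Xs is\<close>: the objects \<open>Xs 0, \<dots>, Xs n\<close> and the arrows
  \<open>is l : Xs l \<rightarrow> Xs (l + 1)\<close> for \<open>l < n\<close> form a series of length \<open>n\<close>; all other values of \<open>Xs\<close>
  and \<open>is\<close> are irrelevant.  The equation \<open>X\<^sub>0 = 0\<close> means that \<open>X\<^sub>0\<close> is some zero object.\<close>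

definition composition_series ::
    "('o, 'm, 'z) add_cat_scheme \<Rightarrow> ('m \<times> 'm) set \<Rightarrow> 'o \<Rightarrow> nat \<Rightarrow> (nat \<Rightarrow> 'o) \<Rightarrow> (nat \<Rightarrow> 'm) \<Rightarrow> bool"
  where
  "composition_series C E X n Xs is \<longleftrightarrow> zero_object C (Xs 0) \<and> Xs n = X \<and>
     (\<forall>l<n. is l \<in> Hom C (Xs l) (Xs (Suc l)) \<and> admissible_monic E (is l) \<and>
        \<not> iso_arr C (is l) \<and> (\<exists>Q. cokernel_object C (is l) Q \<and> E_simple C E Q))"

definition finite_object :: "('o, 'm, 'z) add_cat_scheme \<Rightarrow> ('m \<times> 'm) set \<Rightarrow> 'o \<Rightarrow> bool" where
  "finite_object C E X \<longleftrightarrow> (\<exists>n Xs is. composition_series C E X n Xs is)"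

end

theory Submission
  imports Defs
begin

text \<open>Let \<open>B\<close> be the last proper term of a series of \<open>X\<close> and let \<open>Y \<rightarrow> X\<close> be any admissible monic with
  simple cokernel.  By (AIS), \<open>A = B \<inter> Y\<close> and \<open>P = B + Y\<close> exist as admissible subobjects.  Since
  \<open>X/Y\<close> is simple, \<open>P\<close> is \<open>Y\<close> or \<open>X\<close>.  If \<open>P = Y\<close>, then \<open>B = Y\<close>, as \<open>X/B\<close> is simple too.  If
  \<open>P = X\<close>, then the square is a push-out, so \<open>B/A\<close> and \<open>X/Y\<close> as well as \<open>Y/A\<close> and \<open>X/B\<close> are
  isomorphic.  Induction on the series (applied to \<open>A \<rightarrow> B\<close>) therefore yields a series of \<open>Y\<close>
  whose factors together with \<open>X/Y\<close> are those of \<open>X\<close>.  Taking for \<open>Y\<close> the last proper term of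
  the second series gives uniqueness.\<close>

text \<open>All objects that can serve as \<open>B/A\<close>. Any two members are isomorphic, so an
  equation between classes expresses that two quotients are isomorphic without choosing
  cokernels.\<close>

definition coker_class :: "('o, 'm, 'z) add_cat_scheme \<Rightarrow> 'm \<Rightarrow> 'o set" where
  "coker_class C i = {Q. cokernel_object C i Q}"

section \<open>Rules phrased with \<open>Hom\<close> for isomorphisms, push-outs, kernels and
  cokernels\<close>

lemma HomD:
  assumes "f \<in> Hom C A B"
  shows "f \<in> Arr C" "Dom C f = A" "Cod C f = B"
  using assms by (auto simp: Hom_def)

lemma iso_arrE:
  assumes "iso_arr C f" "f \<in> Hom C A B"
  obtains g where "g \<in> Hom C B A" "g \<cdot>\<^bsub>C\<^esub> f = Id C A" "f \<cdot>\<^bsub>C\<^esub> g = Id C B"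
  using assms by (auto simp: iso_arr_def Hom_def)

lemma iso_arrI:
  assumes "f \<in> Hom C A B" "g \<in> Hom C B A" "g \<cdot>\<^bsub>C\<^esub> f = Id C A" "f \<cdot>\<^bsub>C\<^esub> g = Id C B"
  shows "iso_arr C f"
  using assms by (auto simp: iso_arr_def Hom_def)

lemma is_pushoutI:
  assumes "i \<in> Hom C A B" "f \<in> Hom C A B'" "l \<in> Hom C B P" "k \<in> Hom C B' P"
    and "l \<cdot>\<^bsub>C\<^esub> i = k \<cdot>\<^bsub>C\<^esub> f"
    and "\<And>T p q. \<lbrakk>T \<in> Obj C; p \<in> Hom C B T; q \<in> Hom C B' T; p \<cdot>\<^bsub>C\<^esub> i = q \<cdot>\<^bsub>C\<^esub> f\<rbrakk>
      \<Longrightarrow> \<exists>!u. u \<in> Hom C P T \<and> u \<cdot>\<^bsub>C\<^esub> l = p \<and> u \<cdot>\<^bsub>C\<^esub> k = q"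
  shows "is_pushout C i f l k"
  unfolding is_pushout_def using assms(5,6) HomD[OF assms(1)] HomD[OF assms(2)]
    HomD[OF assms(3)] HomD[OF assms(4)] by simp

lemma is_pushoutE:
  assumes "is_pushout C i f l k"
  obtains A B B' P where
    "i \<in> Hom C A B" "f \<in> Hom C A B'" "l \<in> Hom C B P" "k \<in> Hom C B' P"
    "l \<cdot>\<^bsub>C\<^esub> i = k \<cdot>\<^bsub>C\<^esub> f"
    "\<And>T p q. \<lbrakk>T \<in> Obj C; p \<in> Hom C B T; q \<in> Hom C B' T; p \<cdot>\<^bsub>C\<^esub> i = q \<cdot>\<^bsub>C\<^esub> f\<rbrakk>
      \<Longrightarrow> \<exists>!u. u \<in> Hom C P T \<and> u \<cdot>\<^bsub>C\<^esub> l = p \<and> u \<cdot>\<^bsub>C\<^esub> k = q"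
proof (rule that)
  show "i \<in> Hom C (Dom C i) (Cod C i)" "f \<in> Hom C (Dom C i) (Cod C f)"
    "l \<in> Hom C (Cod C i) (Cod C l)" "k \<in> Hom C (Cod C f) (Cod C l)"
    "l \<cdot>\<^bsub>C\<^esub> i = k \<cdot>\<^bsub>C\<^esub> f"
    using assms by (auto simp: is_pushout_def Hom_def)
  fix T p q
  assume "T \<in> Obj C" "p \<in> Hom C (Cod C i) T" "q \<in> Hom C (Cod C f) T" "p \<cdot>\<^bsub>C\<^esub> i = q \<cdot>\<^bsub>C\<^esub> f"
  then show "\<exists>!u. u \<in> Hom C (Cod C l) T \<and> u \<cdot>\<^bsub>C\<^esub> l = p \<and> u \<cdot>\<^bsub>C\<^esub> k = q"
    using assms unfolding is_pushout_def by blast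
qed

lemma is_pushout_sym:
  assumes "is_pushout C i f l k"
  shows "is_pushout C f i k l"
proof -
  obtain A B B' P where po: "i \<in> Hom C A B" "f \<in> Hom C A B'" "l \<in> Hom C B P" "k \<in> Hom C B' P"
    "l \<cdot>\<^bsub>C\<^esub> i = k \<cdot>\<^bsub>C\<^esub> f"
    and univ: "\<And>T p q. \<lbrakk>T \<in> Obj C; p \<in> Hom C B T; q \<in> Hom C B' T; p \<cdot>\<^bsub>C\<^esub> i = q \<cdot>\<^bsub>C\<^esub> f\<rbrakk>
      \<Longrightarrow> \<exists>!u. u \<in> Hom C P T \<and> u \<cdot>\<^bsub>C\<^esub> l = p \<and> u \<cdot>\<^bsub>C\<^esub> k = q"
    by (rule is_pushoutE[OF assms]) blast
  show ?thesis
  proof (rule is_pushoutI[OF po(2,1,4,3) po(5)[symmetric]])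
    fix T p q assume "T \<in> Obj C" "p \<in> Hom C B' T" "q \<in> Hom C B T" "p \<cdot>\<^bsub>C\<^esub> f = q \<cdot>\<^bsub>C\<^esub> i"
    then show "\<exists>!u. u \<in> Hom C P T \<and> u \<cdot>\<^bsub>C\<^esub> k = p \<and> u \<cdot>\<^bsub>C\<^esub> l = q"
      using univ[of T q p] by (simp add: conj_commute)
  qed
qed

lemma is_cokernelI:
  assumes "i \<in> Hom C A B" "d \<in> Hom C B Q" "d \<cdot>\<^bsub>C\<^esub> i = Zero C A Q"
    and "\<And>T h. \<lbrakk>T \<in> Obj C; h \<in> Hom C B T; h \<cdot>\<^bsub>C\<^esub> i = Zero C A T\<rbrakk>
      \<Longrightarrow> \<exists>!u. u \<in> Hom C Q T \<and> u \<cdot>\<^bsub>C\<^esub> d = h"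
  shows "is_cokernel C i d"
  unfolding is_cokernel_def using assms(3,4) HomD[OF assms(1)] HomD[OF assms(2)] by simp

lemma is_cokernelD:
  assumes "is_cokernel C i d" "i \<in> Hom C A B" "d \<in> Hom C B Q"
  shows "d \<cdot>\<^bsub>C\<^esub> i = Zero C A Q"
    and "\<lbrakk>T \<in> Obj C; h \<in> Hom C B T; h \<cdot>\<^bsub>C\<^esub> i = Zero C A T\<rbrakk>
      \<Longrightarrow> \<exists>!u. u \<in> Hom C Q T \<and> u \<cdot>\<^bsub>C\<^esub> d = h"
  using assms(1) HomD[OF assms(2)] HomD[OF assms(3)] unfolding is_cokernel_def by simp_all

lemma coker_classI:
  assumes "is_cokernel C i d" "d \<in> Hom C B Q"
  shows "Q \<in> coker_class C i"
  using assms HomD(3)[OF assms(2)] by (auto simp: coker_class_def cokernel_object_def)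

lemma coker_classE:
  assumes "Q \<in> coker_class C i" "i \<in> Hom C A B"
  obtains d where "is_cokernel C i d" "d \<in> Hom C B Q"
  using assms by (auto simp: coker_class_def cokernel_object_def is_cokernel_def Hom_def)

lemma is_kernelI:
  assumes "d \<in> Hom C B Q" "i \<in> Hom C A B" "d \<cdot>\<^bsub>C\<^esub> i = Zero C A Q"
    and "\<And>T h. \<lbrakk>T \<in> Obj C; h \<in> Hom C T B; d \<cdot>\<^bsub>C\<^esub> h = Zero C T Q\<rbrakk>
      \<Longrightarrow> \<exists>!u. u \<in> Hom C T A \<and> i \<cdot>\<^bsub>C\<^esub> u = h"
  shows "is_kernel C d i"
  unfolding is_kernel_def using assms(3,4) HomD[OF assms(1)] HomD[OF assms(2)] by simp

lemma is_kernelD: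
  assumes "is_kernel C d i" "i \<in> Hom C A B" "d \<in> Hom C B Q"
  shows "d \<cdot>\<^bsub>C\<^esub> i = Zero C A Q"
    and "\<lbrakk>T \<in> Obj C; h \<in> Hom C T B; d \<cdot>\<^bsub>C\<^esub> h = Zero C T Q\<rbrakk>
      \<Longrightarrow> \<exists>!u. u \<in> Hom C T A \<and> i \<cdot>\<^bsub>C\<^esub> u = h"
  using assms(1) HomD[OF assms(2)] HomD[OF assms(3)] unfolding is_kernel_def by simp_all

lemma zero_object_initial: "\<lbrakk>zero_object C Z; T \<in> Obj C\<rbrakk> \<Longrightarrow> \<exists>!f. f \<in> Hom C Z T"
  and zero_object_terminal: "\<lbrakk>zero_object C Z; T \<in> Obj C\<rbrakk> \<Longrightarrow> \<exists>!f. f \<in> Hom C T Z"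
  by (simp_all add: zero_object_def)

section \<open>Isomorphisms and zero objects\<close>

context category
begin

lemma Hom_Obj:
  assumes "f \<in> Hom C A B"
  shows "A \<in> Obj C" "B \<in> Obj C"
  using assms Dom_in_Obj Cod_in_Obj by (auto simp: Hom_def)

text \<open>The arrow out of \<open>B'\<close> is forced to be \<open>q\<close> after the inverse of
  \<open>b\<close>. Taking an identity for one of the two isomorphisms later reduces invariance of
  cokernels under isomorphism to invariance under push-out.\<close>

lemma iso_square_pushout:
  assumes a: "a \<in> Hom C A A'" "iso_arr C a" and b: "b \<in> Hom C B B'" "iso_arr C b"
    and f: "f \<in> Hom C A B" and l: "l \<in> Hom C A' B'" and eq: "l \<cdot> a = b \<cdot> f"
  shows "is_pushout C a f l b"
proof (rule is_pushoutI[OF a(1) f l b(1) eq])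
  fix T p q assume T: "T \<in> Obj C" and p: "p \<in> Hom C A' T" and q: "q \<in> Hom C B T"
    and pq: "p \<cdot> a = q \<cdot> f"
  obtain a' where a': "a' \<in> Hom C A' A" "a' \<cdot> a = Id C A" "a \<cdot> a' = Id C A'"
    by (rule iso_arrE[OF a(2,1)])
  obtain b' where b': "b' \<in> Hom C B' B" "b' \<cdot> b = Id C B" "b \<cdot> b' = Id C B'"
    by (rule iso_arrE[OF b(2,1)])
  have "l = l \<cdot> (a \<cdot> a')" using Comp_Id[OF l] a'(3) by simp
  also have "\<dots> = (l \<cdot> a) \<cdot> a'" using Comp_assoc[OF a'(1) a(1) l] by simp
  also have "\<dots> = b \<cdot> (f \<cdot> a')" using eq Comp_assoc[OF a'(1) f b(1)] by simp
  finally have l_eq: "l = b \<cdot> (f \<cdot> a')" .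
  have fa': "f \<cdot> a' \<in> Hom C A' B" by (rule Comp_in_Hom[OF a'(1) f])
  let ?u = "q \<cdot> b'"
  have u: "?u \<in> Hom C B' T" by (rule Comp_in_Hom[OF b'(1) q])
  have ub: "?u \<cdot> b = q" using Comp_assoc[OF b(1) b'(1) q] b'(2) Comp_Id[OF q] by simp
  have "?u \<cdot> l = (?u \<cdot> b) \<cdot> (f \<cdot> a')" using l_eq Comp_assoc[OF fa' b(1) u] by simp
  also have "\<dots> = (q \<cdot> f) \<cdot> a'" using ub Comp_assoc[OF a'(1) f q] by simp
  also have "\<dots> = p \<cdot> (a \<cdot> a')" using pq Comp_assoc[OF a'(1) a(1) p] by simp
  finally have ul: "?u \<cdot> l = p" using a'(3) Comp_Id[OF p] by simp
  have "v = ?u" if v: "v \<in> Hom C B' T \<and> v \<cdot> l = p \<and> v \<cdot> b = q" for v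
    using Comp_assoc[OF b'(1) b(1), of v] v b'(3) Comp_Id[of v] by auto
  note uniq = this
  show "\<exists>!u. u \<in> Hom C B' T \<and> u \<cdot> l = p \<and> u \<cdot> b = q"
    by (rule ex1I[OF _ uniq]) (use u ub ul in simp_all)
qed

lemma iso_arr_Id:
  assumes "A \<in> Obj C"
  shows "iso_arr C (Id C A)"
  using iso_arrI[of "Id C A" C A A "Id C A"] Id_in_Hom[OF assms] Comp_Id[OF Id_in_Hom[OF assms]]
  by auto

lemma iso_arr_Comp:
  assumes "f \<in> Hom C A B" "iso_arr C f" "g \<in> Hom C B D" "iso_arr C g"
  shows "iso_arr C (g \<cdot> f)"
proof -
  obtain f' where f': "f' \<in> Hom C B A" "f' \<cdot> f = Id C A" "f \<cdot> f' = Id C B"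
    by (rule iso_arrE[OF assms(2,1)])
  obtain g' where g': "g' \<in> Hom C D B" "g' \<cdot> g = Id C B" "g \<cdot> g' = Id C D"
    by (rule iso_arrE[OF assms(4,3)])
  have gf: "g \<cdot> f \<in> Hom C A D" by (rule Comp_in_Hom[OF assms(1,3)])
  have fg': "f' \<cdot> g' \<in> Hom C D A" by (rule Comp_in_Hom[OF g'(1) f'(1)])
  have "(f' \<cdot> g') \<cdot> (g \<cdot> f) = f' \<cdot> ((g' \<cdot> g) \<cdot> f)"
    using Comp_assoc[OF gf g'(1) f'(1)] Comp_assoc[OF assms(1,3) g'(1)] by simp
  then have 1: "(f' \<cdot> g') \<cdot> (g \<cdot> f) = Id C A" using g'(2) f'(2) Id_Comp[OF assms(1)] by simp
  have "(g \<cdot> f) \<cdot> (f' \<cdot> g') = g \<cdot> ((f \<cdot> f') \<cdot> g')"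
    using Comp_assoc[OF fg' assms(1,3)] Comp_assoc[OF g'(1) f'(1) assms(1)] by simp
  then have 2: "(g \<cdot> f) \<cdot> (f' \<cdot> g') = Id C D" using f'(3) g'(3) Id_Comp[OF g'(1)] by simp
  show ?thesis by (rule iso_arrI[OF gf fg' 1 2])
qed

lemma iso_arr_inverse:
  assumes "f \<in> Hom C A B" "iso_arr C f"
  obtains g where "g \<in> Hom C B A" "iso_arr C g" "g \<cdot> f = Id C A" "f \<cdot> g = Id C B"
proof -
  obtain g where g: "g \<in> Hom C B A" "g \<cdot> f = Id C A" "f \<cdot> g = Id C B"
    by (rule iso_arrE[OF assms(2,1)])
  show ?thesis by (rule that[OF g(1) iso_arrI[OF g(1) assms(1) g(3,2)] g(2,3)])
qed

lemma zero_object_isomorphic: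
  assumes "zero_object C Z" "f \<in> Hom C Z A" "iso_arr C f"
  shows "zero_object C A"
proof -
  obtain g where g: "g \<in> Hom C A Z" "g \<cdot> f = Id C Z" "f \<cdot> g = Id C A"
    by (rule iso_arrE[OF assms(3,2)])
  have "\<exists>!h. h \<in> Hom C A T" if T: "T \<in> Obj C" for T
  proof -
    obtain z where z: "z \<in> Hom C Z T" "\<And>z'. z' \<in> Hom C Z T \<Longrightarrow> z' = z"
      using zero_object_initial[OF assms(1) T] by blast
    have "h = z \<cdot> g" if h: "h \<in> Hom C A T" for h
    proof -
      have "h \<cdot> f = z" using z(2) Comp_in_Hom[OF assms(2) h] .
      then show ?thesis using Comp_assoc[OF g(1) assms(2) h] g(3) Comp_Id[OF h] by simp
    qed
    then show ?thesis using Comp_in_Hom[OF g(1) z(1)] by metis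
  qed
  moreover have "\<exists>!h. h \<in> Hom C T A" if T: "T \<in> Obj C" for T
  proof -
    obtain z where z: "z \<in> Hom C T Z" "\<And>z'. z' \<in> Hom C T Z \<Longrightarrow> z' = z"
      using zero_object_terminal[OF assms(1) T] by blast
    have "h = f \<cdot> z" if h: "h \<in> Hom C T A" for h
    proof -
      have "g \<cdot> h = z" using z(2) Comp_in_Hom[OF h g(1)] .
      then show ?thesis using Comp_assoc[OF h g(1) assms(2)] g(3) Id_Comp[OF h] by simp
    qed
    then show ?thesis using Comp_in_Hom[OF z(1) assms(2)] by metis
  qed
  ultimately show ?thesis using Hom_Obj[OF assms(2)] by (simp add: zero_object_def)
qed

end

section \<open>Zero arrows and cokernel classes\<close>

context additive_category
begin

lemma Zero_in_Hom: "\<lbrakk>A \<in> Obj C; B \<in> Obj C\<rbrakk> \<Longrightarrow> Zero C A B \<in> Hom C A B"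
  using group.is_monoid[OF comm_group.axioms(2)[OF hom_comm_group]] monoid.one_closed
  by (fastforce simp: hom_group_def)

text \<open>Cancellation in the Hom group. Bilinearity makes a composite with a zero arrow
  idempotent under addition, and this identifies it as zero.\<close>

lemma Plus_idem_imp_Zero:
  assumes "x \<in> Hom C A B" "x \<boxplus> x = x"
  shows "x = Zero C A B"
proof -
  interpret comm_group "hom_group C A B" using hom_comm_group Hom_Obj[OF assms(1)] by blast
  show ?thesis using l_cancel_one[of x x] assms by (simp add: hom_group_def)
qed

lemma Zero_Plus_Zero:
  assumes "A \<in> Obj C" "B \<in> Obj C"
  shows "Zero C A B \<boxplus> Zero C A B = Zero C A B"
proof -
  interpret comm_group "hom_group C A B" using hom_comm_group assms by blast
  show ?thesis using l_one[of "Zero C A B"] Zero_in_Hom[OF assms] by (simp add: hom_group_def)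
qed

lemma Comp_Zero:
  assumes "g \<in> Hom C B D" "A \<in> Obj C"
  shows "g \<cdot> Zero C A B = Zero C A D"
proof (rule Plus_idem_imp_Zero)
  note z = Zero_in_Hom[OF assms(2) Hom_Obj(1)[OF assms(1)]]
  show "g \<cdot> Zero C A B \<in> Hom C A D" by (rule Comp_in_Hom[OF z assms(1)])
  show "(g \<cdot> Zero C A B) \<boxplus> (g \<cdot> Zero C A B) = g \<cdot> Zero C A B"
    using Comp_Plus_right[OF z z assms(1)] Zero_Plus_Zero[OF assms(2) Hom_Obj(1)[OF assms(1)]]
    by simp
qed

lemma Zero_Comp:
  assumes "f \<in> Hom C A B" "D \<in> Obj C"
  shows "Zero C B D \<cdot> f = Zero C A D"
proof (rule Plus_idem_imp_Zero)
  note z = Zero_in_Hom[OF Hom_Obj(2)[OF assms(1)] assms(2)]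
  show "Zero C B D \<cdot> f \<in> Hom C A D" by (rule Comp_in_Hom[OF assms(1) z])
  show "(Zero C B D \<cdot> f) \<boxplus> (Zero C B D \<cdot> f) = Zero C B D \<cdot> f"
    using Comp_Plus_left[OF assms(1) z z] Zero_Plus_Zero[OF Hom_Obj(2)[OF assms(1)] assms(2)]
    by simp
qed

lemma cokernel_unique:
  assumes i: "i \<in> Hom C A B" and d: "is_cokernel C i d" "d \<in> Hom C B Q"
    and d': "is_cokernel C i d'" "d' \<in> Hom C B Q'"
  obtains \<phi> where "\<phi> \<in> Hom C Q Q'" "iso_arr C \<phi>"
proof -
  note Q = d(2) is_cokernelD[OF d(1) i d(2)] and Q' = d'(2) is_cokernelD[OF d'(1) i d'(2)]
  note QO = Hom_Obj(2)[OF Q(1)] and QO' = Hom_Obj(2)[OF Q'(1)]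
  obtain \<phi> where \<phi>: "\<phi> \<in> Hom C Q Q'" "\<phi> \<cdot> d = d'" using Q(3)[OF QO' Q'(1,2)] by blast
  obtain \<psi> where \<psi>: "\<psi> \<in> Hom C Q' Q" "\<psi> \<cdot> d' = d" using Q'(3)[OF QO Q(1,2)] by blast
  have "(\<psi> \<cdot> \<phi>) \<cdot> d = d" using Comp_assoc[OF Q(1) \<phi>(1) \<psi>(1)] \<phi>(2) \<psi>(2) by simp
  then have 1: "\<psi> \<cdot> \<phi> = Id C Q"
    using Q(3)[OF QO Q(1,2)] Comp_in_Hom[OF \<phi>(1) \<psi>(1)] Id_in_Hom[OF QO] Id_Comp[OF Q(1)] by blast
  have "(\<phi> \<cdot> \<psi>) \<cdot> d' = d'" using Comp_assoc[OF Q'(1) \<psi>(1) \<phi>(1)] \<phi>(2) \<psi>(2) by simp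
  then have 2: "\<phi> \<cdot> \<psi> = Id C Q'"
    using Q'(3)[OF QO' Q'(1,2)] Comp_in_Hom[OF \<psi>(1) \<phi>(1)] Id_in_Hom[OF QO'] Id_Comp[OF Q'(1)]
    by blast
  show ?thesis
    by (rule that[OF \<phi>(1) iso_arrI[OF \<phi>(1) \<psi>(1) 1 2]])
qed

lemma coker_class_isomorphic:
  assumes "Q \<in> coker_class C i" "Q' \<in> coker_class C i"
  obtains \<phi> where "\<phi> \<in> Hom C Q Q'" "iso_arr C \<phi>"
proof -
  obtain d where d: "is_cokernel C i d" "Cod C d = Q"
    using assms(1) by (auto simp: coker_class_def cokernel_object_def)
  have i: "i \<in> Hom C (Dom C i) (Cod C i)" and dH: "d \<in> Hom C (Cod C i) Q"
    using d by (auto simp: is_cokernel_def Hom_def)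
  obtain d' where d': "is_cokernel C i d'" "d' \<in> Hom C (Cod C i) Q'"
    by (rule coker_classE[OF assms(2) i])
  show ?thesis by (rule cokernel_unique[OF i d(1) dH d' that])
qed

text \<open>Arrows out of \<open>P\<close> that kill \<open>l\<close> correspond to arrows out of
  \<open>B'\<close> that kill \<open>f\<close>: restrict along \<open>k\<close>, or extend by zero
  on \<open>B\<close>. So both arrows have the same cokernel objects.\<close>

lemma coker_class_pushout:
  assumes "is_pushout C i f l k"
  shows "coker_class C f = coker_class C l"
proof -
  obtain A B B' P where i: "i \<in> Hom C A B" and f: "f \<in> Hom C A B'" and l: "l \<in> Hom C B P"
    and k: "k \<in> Hom C B' P" and eq: "l \<cdot> i = k \<cdot> f"
    and univ: "\<And>T p q. \<lbrakk>T \<in> Obj C; p \<in> Hom C B T; q \<in> Hom C B' T; p \<cdot> i = q \<cdot> f\<rbrakk>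
      \<Longrightarrow> \<exists>!u. u \<in> Hom C P T \<and> u \<cdot> l = p \<and> u \<cdot> k = q"
    by (rule is_pushoutE[OF assms]) blast
  note AO = Hom_Obj(1)[OF i] and BO = Hom_Obj(2)[OF i]
  have ext: "\<exists>!u. u \<in> Hom C P T \<and> u \<cdot> l = Zero C B T \<and> u \<cdot> k = q"
    if T: "T \<in> Obj C" and q: "q \<in> Hom C B' T" "q \<cdot> f = Zero C A T" for T q
    using univ[OF T Zero_in_Hom[OF BO T] q(1)] Zero_Comp[OF i T] q(2) by simp
  have restr: "(h \<cdot> k) \<cdot> f = Zero C A T" if h: "h \<in> Hom C P T" "h \<cdot> l = Zero C B T" for h T
    using Comp_assoc[OF f k h(1)] Comp_assoc[OF i l h(1)] eq h(2) Zero_Comp[OF i Hom_Obj(2)[OF h(1)]]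
    by simp
  have "Q \<in> coker_class C f" if "Q \<in> coker_class C l" for Q
  proof -
    obtain d where d: "is_cokernel C l d" "d \<in> Hom C P Q"
      by (rule coker_classE[OF \<open>Q \<in> coker_class C l\<close> l])
    note dH = d(2) is_cokernelD[OF d(1) l d(2)]
    have dk: "d \<cdot> k \<in> Hom C B' Q" by (rule Comp_in_Hom[OF k dH(1)])
    have "is_cokernel C f (d \<cdot> k)"
    proof (rule is_cokernelI[OF f dk restr[OF dH(1,2)]])
      fix T h assume T: "T \<in> Obj C" and h: "h \<in> Hom C B' T" "h \<cdot> f = Zero C A T"
      obtain h' where h': "h' \<in> Hom C P T" "h' \<cdot> l = Zero C B T" "h' \<cdot> k = h"
        and h'_uniq: "\<And>h''. \<lbrakk>h'' \<in> Hom C P T; h'' \<cdot> l = Zero C B T; h'' \<cdot> k = h\<rbrakk> \<Longrightarrow> h'' = h'"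
        using ext[OF T h] by blast
      \<comment> \<open>The two factorisation problems have the same solutions \<open>u\<close>, so
        existence and uniqueness transfer together.\<close>
      have key: "u \<cdot> (d \<cdot> k) = h \<longleftrightarrow> u \<cdot> d = h'" if u: "u \<in> Hom C Q T" for u
      proof -
        have "(u \<cdot> d) \<cdot> l = Zero C B T"
          using Comp_assoc[OF l dH(1) u] dH(2) Comp_Zero[OF u BO] by simp
        then show ?thesis
          using h'_uniq[OF Comp_in_Hom[OF dH(1) u]] h'(3) Comp_assoc[OF k dH(1) u] by auto
      qed
      show "\<exists>!u. u \<in> Hom C Q T \<and> u \<cdot> (d \<cdot> k) = h"
        using dH(3)[OF T h'(1,2)] key by blast
    qed
    then show ?thesis using dk by (rule coker_classI)
  qed
  moreover have "Q \<in> coker_class C l" if "Q \<in> coker_class C f" for Q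
  proof -
    obtain e where e: "is_cokernel C f e" "e \<in> Hom C B' Q"
      by (rule coker_classE[OF \<open>Q \<in> coker_class C f\<close> f])
    note eH = e(2) is_cokernelD[OF e(1) f e(2)]
    obtain d where d: "d \<in> Hom C P Q" "d \<cdot> l = Zero C B Q" "d \<cdot> k = e"
      using ext[OF Hom_Obj(2)[OF eH(1)] eH(1,2)] by blast
    have "is_cokernel C l d"
    proof (rule is_cokernelI[OF l d(1,2)])
      fix T h assume T: "T \<in> Obj C" and h: "h \<in> Hom C P T" "h \<cdot> l = Zero C B T"
      note hk = Comp_in_Hom[OF k h(1)] and hkf = restr[OF h]
      have key: "u \<cdot> d = h \<longleftrightarrow> u \<cdot> e = h \<cdot> k" if u: "u \<in> Hom C Q T" for u
      proof -
        have "(u \<cdot> d) \<cdot> l = Zero C B T"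
          using Comp_assoc[OF l d(1) u] d(2) Comp_Zero[OF u BO] by simp
        then show ?thesis
          using ext[OF T hk hkf] Comp_in_Hom[OF d(1) u] h Comp_assoc[OF k d(1) u] d(3) by metis
      qed
      show "\<exists>!u. u \<in> Hom C Q T \<and> u \<cdot> d = h"
        using eH(3)[OF T hk hkf] key by blast
    qed
    then show ?thesis using d(1) by (rule coker_classI)
  qed
  ultimately show ?thesis by blast
qed

text \<open>The commutative square with opposite sides \<open>Id C A\<close> and
  \<open>\<phi>\<close> is a push-out.\<close>

lemma coker_class_iso_Comp:
  assumes "i \<in> Hom C A B" "\<phi> \<in> Hom C B B'" "iso_arr C \<phi>"
  shows "coker_class C (\<phi> \<cdot> i) = coker_class C i"
proof -
  note A = Hom_Obj(1)[OF assms(1)]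
  note ci = Comp_in_Hom[OF assms(1,2)]
  show ?thesis
    by (rule coker_class_pushout[OF iso_square_pushout, symmetric])
      (rule Id_in_Hom[OF A] iso_arr_Id[OF A] assms ci Comp_Id[OF ci])+
qed

lemma coker_class_Comp_iso:
  assumes "i \<in> Hom C A B" "\<phi> \<in> Hom C A' A" "iso_arr C \<phi>"
  shows "coker_class C (i \<cdot> \<phi>) = coker_class C i"
proof -
  note B = Hom_Obj(2)[OF assms(1)]
  note ci = Comp_in_Hom[OF assms(2,1)]
  show ?thesis
    by (rule coker_class_pushout[OF iso_square_pushout])
      (rule Id_in_Hom[OF B] iso_arr_Id[OF B] assms ci Id_Comp[OF ci, symmetric])+
qed

text \<open>An arrow \<open>h\<close> factors through \<open>d \<cdot> \<psi>\<close> exactly as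
  \<open>h \<cdot> \<phi>\<close> factors through \<open>d\<close>. With the kernel version below,
  this moves a kernel-cokernel pair along an isomorphism of its middle object, as
  \<open>E_iso_closed\<close> requires.\<close>

lemma is_cokernel_Comp_inverse:
  assumes i: "i \<in> Hom C A B" and d: "d \<in> Hom C B Q" "is_cokernel C i d"
    and \<phi>: "\<phi> \<in> Hom C B B'" "\<psi> \<in> Hom C B' B" "\<psi> \<cdot> \<phi> = Id C B" "\<phi> \<cdot> \<psi> = Id C B'"
  shows "is_cokernel C (\<phi> \<cdot> i) (d \<cdot> \<psi>)"
proof (rule is_cokernelI)
  show ci: "\<phi> \<cdot> i \<in> Hom C A B'" by (rule Comp_in_Hom[OF i \<phi>(1)])
  show d\<psi>: "d \<cdot> \<psi> \<in> Hom C B' Q" by (rule Comp_in_Hom[OF \<phi>(2) d(1)])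
  note univ = is_cokernelD[OF d(2) i d(1)]
  have "(d \<cdot> \<psi>) \<cdot> \<phi> = d" using Comp_assoc[OF \<phi>(1,2) d(1)] \<phi>(3) Comp_Id[OF d(1)] by simp
  then show "(d \<cdot> \<psi>) \<cdot> (\<phi> \<cdot> i) = Zero C A Q"
    using Comp_assoc[OF i \<phi>(1) d\<psi>] univ(1) by simp
  fix T h assume T: "T \<in> Obj C" and h: "h \<in> Hom C B' T" "h \<cdot> (\<phi> \<cdot> i) = Zero C A T"
  have h\<phi>: "h \<cdot> \<phi> \<in> Hom C B T" by (rule Comp_in_Hom[OF \<phi>(1) h(1)])
  have h\<phi>i: "(h \<cdot> \<phi>) \<cdot> i = Zero C A T" using Comp_assoc[OF i \<phi>(1) h(1)] h(2) by simp
  have "u \<cdot> (d \<cdot> \<psi>) = h \<longleftrightarrow> u \<cdot> d = h \<cdot> \<phi>" if u: "u \<in> Hom C Q T" for u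
  proof -
    note ud = Comp_in_Hom[OF d(1) u]
    have "((u \<cdot> d) \<cdot> \<psi>) \<cdot> \<phi> = u \<cdot> d"
      using Comp_assoc[OF \<phi>(1,2) ud] \<phi>(3) Comp_Id[OF ud] by simp
    moreover have "(h \<cdot> \<phi>) \<cdot> \<psi> = h" using Comp_assoc[OF \<phi>(2,1) h(1)] \<phi>(4) Comp_Id[OF h(1)] by simp
    ultimately show ?thesis using Comp_assoc[OF \<phi>(2) d(1) u] by metis
  qed
  then show "\<exists>!u. u \<in> Hom C Q T \<and> u \<cdot> (d \<cdot> \<psi>) = h" using univ(2)[OF T h\<phi> h\<phi>i] by blast
qed

lemma is_kernel_Comp_inverse:
  assumes i: "i \<in> Hom C A B" and d: "d \<in> Hom C B Q" "is_kernel C d i"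
    and \<phi>: "\<phi> \<in> Hom C B B'" "\<psi> \<in> Hom C B' B" "\<psi> \<cdot> \<phi> = Id C B" "\<phi> \<cdot> \<psi> = Id C B'"
  shows "is_kernel C (d \<cdot> \<psi>) (\<phi> \<cdot> i)"
proof (rule is_kernelI)
  show ci: "\<phi> \<cdot> i \<in> Hom C A B'" by (rule Comp_in_Hom[OF i \<phi>(1)])
  show d\<psi>: "d \<cdot> \<psi> \<in> Hom C B' Q" by (rule Comp_in_Hom[OF \<phi>(2) d(1)])
  note univ = is_kernelD[OF d(2) i d(1)]
  have "(d \<cdot> \<psi>) \<cdot> \<phi> = d" using Comp_assoc[OF \<phi>(1,2) d(1)] \<phi>(3) Comp_Id[OF d(1)] by simp
  then show "(d \<cdot> \<psi>) \<cdot> (\<phi> \<cdot> i) = Zero C A Q"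
    using Comp_assoc[OF i \<phi>(1) d\<psi>] univ(1) by simp
  fix T h assume T: "T \<in> Obj C" and h: "h \<in> Hom C T B'" "(d \<cdot> \<psi>) \<cdot> h = Zero C T Q"
  have \<psi>h: "\<psi> \<cdot> h \<in> Hom C T B" by (rule Comp_in_Hom[OF h(1) \<phi>(2)])
  have d\<psi>h: "d \<cdot> (\<psi> \<cdot> h) = Zero C T Q" using Comp_assoc[OF h(1) \<phi>(2) d(1)] h(2) by simp
  have "(\<phi> \<cdot> i) \<cdot> u = h \<longleftrightarrow> i \<cdot> u = \<psi> \<cdot> h" if u: "u \<in> Hom C T A" for u
  proof -
    note iu = Comp_in_Hom[OF u i]
    have "\<psi> \<cdot> (\<phi> \<cdot> (i \<cdot> u)) = i \<cdot> u"
      using Comp_assoc[OF iu \<phi>(1,2)] \<phi>(3) Id_Comp[OF iu] by simp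
    moreover have "\<phi> \<cdot> (\<psi> \<cdot> h) = h" using Comp_assoc[OF h(1) \<phi>(2,1)] \<phi>(4) Id_Comp[OF h(1)] by simp
    ultimately show ?thesis using Comp_assoc[OF u i \<phi>(1)] by metis
  qed
  then show "\<exists>!u. u \<in> Hom C T A \<and> (\<phi> \<cdot> i) \<cdot> u = h" using univ(2)[OF T \<psi>h d\<psi>h] by blast
qed

end

section \<open>Admissible monics, simple objects and vanishing cokernels\<close>

context exact_category
begin

lemma admissible_monicE:
  assumes "admissible_monic E i" "i \<in> Hom C A B"
  obtains d Q where "(i, d) \<in> E" "d \<in> Hom C B Q" "is_kernel C d i" "is_cokernel C i d"
    "Q \<in> coker_class C i"
proof -
  obtain d where d: "(i, d) \<in> E" using assms(1) by (auto simp: admissible_monic_def)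
  then have kc: "is_kernel C d i" "is_cokernel C i d"
    using E_pairs by (auto simp: kernel_cokernel_pair_def)
  have "d \<in> Hom C B (Cod C d)" using kc(2) assms(2) by (auto simp: is_cokernel_def Hom_def)
  then show ?thesis using that d kc coker_classI[OF kc(2)] by blast
qed

text \<open>The axioms make identities admissible. A pair \<open>(Id C A, d)\<close> in
  \<open>E\<close> is carried to \<open>(\<phi>, d \<cdot> \<psi>)\<close> by the isomorphisms
  \<open>Id C A\<close>, \<open>\<phi>\<close> and \<open>Id C Q\<close>.\<close>

lemma admissible_monic_iso:
  assumes \<phi>: "\<phi> \<in> Hom C A B" "iso_arr C \<phi>"
  shows "admissible_monic E \<phi>"
proof -
  note A = Hom_Obj(1)[OF \<phi>(1)]
  obtain \<psi> where \<psi>: "\<psi> \<in> Hom C B A" "\<psi> \<cdot> \<phi> = Id C A" "\<phi> \<cdot> \<psi> = Id C B"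
    by (rule iso_arrE[OF \<phi>(2,1)])
  obtain d Q where d: "(Id C A, d) \<in> E" "d \<in> Hom C A Q" "is_kernel C d (Id C A)"
    "is_cokernel C (Id C A) d"
    by (rule admissible_monicE[OF Id_admissible_monic[OF A] Id_in_Hom[OF A]])
  have kcp: "kernel_cokernel_pair C \<phi> (d \<cdot> \<psi>)"
    using is_kernel_Comp_inverse[OF Id_in_Hom[OF A] d(2,3) \<phi>(1) \<psi>]
      is_cokernel_Comp_inverse[OF Id_in_Hom[OF A] d(2,4) \<phi>(1) \<psi>] Comp_Id[OF \<phi>(1)]
    by (simp add: kernel_cokernel_pair_def)
  note Q = Hom_Obj(2)[OF d(2)]
  note d\<psi> = Comp_in_Hom[OF \<psi>(1) d(2)]
  have "Id C Q \<cdot> d = (d \<cdot> \<psi>) \<cdot> \<phi>"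
    using Comp_assoc[OF \<phi>(1) \<psi>(1) d(2)] \<psi>(2) Comp_Id[OF d(2)] Id_Comp[OF d(2)] by simp
  then have "pair_isomorphic C (Id C A) d \<phi> (d \<cdot> \<psi>)"
    using \<phi> iso_arr_Id[OF A] iso_arr_Id[OF Q] Id_in_Hom[OF A] Id_in_Hom[OF Q]
      HomD[OF Id_in_Hom[OF A]] HomD[OF \<phi>(1)] HomD[OF d(2)] HomD[OF d\<psi>]
    unfolding pair_isomorphic_def by metis
  then show ?thesis using E_iso_closed[OF d(1) kcp] by (auto simp: admissible_monic_def)
qed

lemma admissible_monic_iso_Comp:
  assumes "admissible_monic E i" "i \<in> Hom C A B" "\<phi> \<in> Hom C B B'" "iso_arr C \<phi>"
  shows "admissible_monic E (\<phi> \<cdot> i)"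
  using admissible_monic_Comp[OF assms(1) admissible_monic_iso[OF assms(3,4)]]
    HomD[OF assms(2)] HomD[OF assms(3)] by simp

text \<open>A subobject \<open>i\<close> of \<open>S'\<close> becomes the subobject
  \<open>\<psi> \<cdot> i\<close> of \<open>S\<close> with the same domain, and \<open>i\<close> is
  recovered by composing with \<open>\<phi>\<close>.\<close>

lemma E_simple_isomorphic:
  assumes S: "E_simple C E S" and \<phi>: "\<phi> \<in> Hom C S S'" "iso_arr C \<phi>"
  shows "E_simple C E S'"
proof -
  obtain \<psi> where \<psi>: "\<psi> \<in> Hom C S' S" "iso_arr C \<psi>" "\<psi> \<cdot> \<phi> = Id C S" "\<phi> \<cdot> \<psi> = Id C S'"
    by (rule iso_arr_inverse[OF \<phi>])
  have "zero_object C (Dom C i) \<or> iso_arr C i"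
    if i: "admissible_monic E i" "Cod C i = S'" for i
  proof -
    obtain d where "(i, d) \<in> E" using i(1) by (auto simp: admissible_monic_def)
    then have "i \<in> Arr C" using E_pairs by (auto simp: kernel_cokernel_pair_def is_kernel_def)
    then have iH: "i \<in> Hom C (Dom C i) S'" using i(2) by (simp add: Hom_def)
    note pi = Comp_in_Hom[OF iH \<psi>(1)]
    have "zero_object C (Dom C (\<psi> \<cdot> i)) \<or> iso_arr C (\<psi> \<cdot> i)"
      using S admissible_monic_iso_Comp[OF i(1) iH \<psi>(1,2)] HomD(3)[OF pi]
      unfolding E_simple_def by blast
    moreover have "\<phi> \<cdot> (\<psi> \<cdot> i) = i" using Comp_assoc[OF iH \<psi>(1) \<phi>(1)] \<psi>(4) Id_Comp[OF iH] by simp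
    ultimately show ?thesis using iso_arr_Comp[OF pi _ \<phi>] HomD[OF pi] by auto
  qed
  moreover have "\<not> zero_object C S'"
    using zero_object_isomorphic[OF _ \<psi>(1,2)] S by (auto simp: E_simple_def)
  ultimately show ?thesis using Hom_Obj(2)[OF \<phi>(1)] by (simp add: E_simple_def)
qed

lemma E_simple_coker_class:
  assumes "Q \<in> coker_class C i" "E_simple C E Q" "Q' \<in> coker_class C i"
  shows "E_simple C E Q'"
  using coker_class_isomorphic[OF assms(1,3)] E_simple_isomorphic[OF assms(2)] by metis

text \<open>The arrow \<open>i\<close> is the kernel of \<open>d\<close>, and \<open>d\<close> is
  zero because its codomain is a zero object. Hence the identity of \<open>B\<close> factors through
  \<open>i\<close>, and uniqueness of factorisations makes this right inverse two-sided.\<close>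

lemma iso_if_zero_cokernel:
  assumes i: "admissible_monic E i" "i \<in> Hom C A B" and Z: "Z \<in> coker_class C i" "zero_object C Z"
  shows "iso_arr C i"
proof -
  obtain d Q where d: "d \<in> Hom C B Q" "is_kernel C d i" "Q \<in> coker_class C i"
    by (rule admissible_monicE[OF i])
  have Q: "zero_object C Q"
    using coker_class_isomorphic[OF Z(1) d(3)] zero_object_isomorphic[OF Z(2)] by metis
  note univ = is_kernelD[OF d(2) i(2) d(1)]
  note A = Hom_Obj(1)[OF i(2)] and B = Hom_Obj(2)[OF i(2)]
  have "d = Zero C B Q" using zero_object_terminal[OF Q B] d(1) Zero_in_Hom[OF B Hom_Obj(2)[OF d(1)]]
    by blast
  then obtain v where v: "v \<in> Hom C B A" "i \<cdot> v = Id C B"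
    using univ(2)[OF B Id_in_Hom[OF B]] Comp_Id[OF d(1)] by auto
  have "i \<cdot> (v \<cdot> i) = i" using Comp_assoc[OF i(2) v(1) i(2)] v(2) Id_Comp[OF i(2)] by simp
  then have "v \<cdot> i = Id C A"
    using univ(2)[OF A i(2) univ(1)] Comp_in_Hom[OF i(2) v(1)] Id_in_Hom[OF A] Comp_Id[OF i(2)]
    by metis
  then show ?thesis using iso_arrI[OF i(2) v(1)] v(2) by blast
qed

text \<open>An arrow that kills an isomorphism is zero, so the zero arrow to any zero object is a
  cokernel; every other cokernel object is isomorphic to that one.\<close>

lemma zero_cokernel_if_iso:
  assumes i: "i \<in> Hom C A B" "iso_arr C i" and Q: "Q \<in> coker_class C i"
  shows "zero_object C Q"
proof -
  obtain Z where Z: "zero_object C Z" using zero_object_exists by blast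
  then have ZO: "Z \<in> Obj C" by (simp add: zero_object_def)
  note B = Hom_Obj(2)[OF i(1)] and A = Hom_Obj(1)[OF i(1)]
  note z = Zero_in_Hom[OF B ZO]
  obtain j where j: "j \<in> Hom C B A" "j \<cdot> i = Id C A" "i \<cdot> j = Id C B"
    by (rule iso_arrE[OF i(2,1)])
  have "is_cokernel C i (Zero C B Z)"
  proof (rule is_cokernelI[OF i(1) z Zero_Comp[OF i(1) ZO]])
    fix T h assume T: "T \<in> Obj C" and h: "h \<in> Hom C B T" "h \<cdot> i = Zero C A T"
    have "h = Zero C A T \<cdot> j" using Comp_assoc[OF j(1) i(1) h(1)] h(2) j(3) Comp_Id[OF h(1)] by simp
    then have h0: "h = Zero C B T" using Zero_Comp[OF j(1) T] by simp
    have "u \<cdot> Zero C B Z = h" if "u \<in> Hom C Z T" for u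
      using Comp_Zero[OF that B] h0 by simp
    then show "\<exists>!u. u \<in> Hom C Z T \<and> u \<cdot> Zero C B Z = h"
      using zero_object_initial[OF Z T] by blast
  qed
  then have "Z \<in> coker_class C i" using z by (rule coker_classI)
  then show ?thesis using coker_class_isomorphic[OF _ Q] zero_object_isomorphic[OF Z] by metis
qed

text \<open>Noether's third isomorphism theorem is used here: \<open>P/B\<close> is an admissible subobject of the
  simple object \<open>D/B\<close>, via the push-out of \<open>u\<close> along \<open>P \<rightarrow> P/B\<close>.\<close>

lemma simple_cokernel_maximal:
  assumes l: "admissible_monic E l" "l \<in> Hom C B P" and u: "admissible_monic E u" "u \<in> Hom C P D"
    and S: "S \<in> coker_class C (u \<cdot> l)" "E_simple C E S"
  shows "iso_arr C l \<or> iso_arr C u"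
proof -
  obtain d Q where dH: "d \<in> Hom C P Q" and coker: "is_cokernel C l d" and Q: "Q \<in> coker_class C l"
    by (rule admissible_monicE[OF l])
  note d = is_cokernelD[OF coker l(2) dH]
  obtain e k where po: "is_pushout C u d e k" and k: "admissible_monic E k"
    using admissible_monic_pushout[OF u(1), of d] HomD[OF dH] HomD[OF u(2)] by metis
  define R where "R = Cod C e"
  have eH: "e \<in> Hom C D R" and kH: "k \<in> Hom C Q R" and eq: "e \<cdot> u = k \<cdot> d"
    using po HomD[OF u(2)] HomD[OF dH] unfolding is_pushout_def R_def by (simp_all add: Hom_def)
  have univ: "\<exists>!v. v \<in> Hom C R T \<and> v \<cdot> e = p \<and> v \<cdot> k = q"
    if "T \<in> Obj C" "p \<in> Hom C D T" "q \<in> Hom C Q T" "p \<cdot> u = q \<cdot> d" for T p q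
    using po that unfolding is_pushout_def R_def HomD[OF u(2)] HomD[OF dH] by blast
  have ulH: "u \<cdot> l \<in> Hom C B D" by (rule Comp_in_Hom[OF l(2) u(2)])
  \<comment> \<open>This identifies \<open>R\<close> with \<open>D/B\<close>, so that
    \<open>k\<close> is the inclusion of \<open>P/B\<close> into \<open>D/B\<close>.\<close>
  have "is_cokernel C (u \<cdot> l) e"
  proof (rule is_cokernelI[OF ulH eH])
    have "e \<cdot> (u \<cdot> l) = k \<cdot> (d \<cdot> l)"
      using Comp_assoc[OF l(2) u(2) eH] Comp_assoc[OF l(2) dH kH] eq by simp
    then show "e \<cdot> (u \<cdot> l) = Zero C B R" using d(1) Comp_Zero[OF kH Hom_Obj(1)[OF l(2)]] by simp
    fix T h assume T: "T \<in> Obj C" and h: "h \<in> Hom C D T" "h \<cdot> (u \<cdot> l) = Zero C B T"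
    note hu = Comp_in_Hom[OF u(2) h(1)]
    have hul: "(h \<cdot> u) \<cdot> l = Zero C B T" using Comp_assoc[OF l(2) u(2) h(1)] h(2) by simp
    obtain q where q: "q \<in> Hom C Q T" "q \<cdot> d = h \<cdot> u"
      and q_uniq: "\<And>q'. \<lbrakk>q' \<in> Hom C Q T; q' \<cdot> d = h \<cdot> u\<rbrakk> \<Longrightarrow> q' = q"
      using d(2)[OF T hu hul] by blast
    \<comment> \<open>The push-out gives uniqueness for prescribed composites with both
      \<open>e\<close> and \<open>k\<close>. The second composite is already forced by the first, so
      \<open>e\<close> alone suffices.\<close>
    have "v \<cdot> k = q" if v: "v \<in> Hom C R T" "v \<cdot> e = h" for v
    proof (rule q_uniq)
      show "v \<cdot> k \<in> Hom C Q T" by (rule Comp_in_Hom[OF kH v(1)])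
      show "(v \<cdot> k) \<cdot> d = h \<cdot> u"
        using Comp_assoc[OF dH kH v(1)] Comp_assoc[OF u(2) eH v(1)] eq v(2) by simp
    qed
    then show "\<exists>!v. v \<in> Hom C R T \<and> v \<cdot> e = h"
      using univ[OF T h(1) q(1)] q(2) by metis
  qed
  then have "R \<in> coker_class C (u \<cdot> l)" using eH by (rule coker_classI)
  then have "E_simple C E R" by (rule E_simple_coker_class[OF S])
  then consider "zero_object C Q" | "iso_arr C k"
    using k HomD[OF kH] by (auto simp: E_simple_def)
  then show ?thesis
  proof cases
    case 1
    then show ?thesis using iso_if_zero_cokernel[OF l Q] by blast
  next
    case 2
    \<comment> \<open>Here \<open>P/B\<close> is all of \<open>D/B\<close>. The push-out read the
      other way gives \<open>u\<close> and \<open>k\<close> the same cokernels, so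
      \<open>D/P\<close> vanishes.\<close>
    obtain W where W: "W \<in> coker_class C u" by (rule admissible_monicE[OF u])
    then have "W \<in> coker_class C k" using coker_class_pushout[OF is_pushout_sym[OF po]] by simp
    then have "zero_object C W" by (rule zero_cokernel_if_iso[OF kH 2])
    then show ?thesis using iso_if_zero_cokernel[OF u W] by blast
  qed
qed

lemma not_iso_if_simple_cokernel:
  assumes "i \<in> Hom C A B" "S \<in> coker_class C i" "E_simple C E S"
  shows "\<not> iso_arr C i"
  using zero_cokernel_if_iso[OF assms(1) _ assms(2)] assms(3) by (auto simp: E_simple_def)

text \<open>A cokernel \<open>d\<close> out of a zero object is an isomorphism: its inverse is the
  only arrow \<open>b\<close> back, because \<open>d\<close> can be cancelled in
  \<open>(d \<cdot> b) \<cdot> d = d\<close>. This settles the base cases of both later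
  inductions.\<close>

lemma zero_object_no_simple_cokernel:
  assumes "zero_object C B" "i \<in> Hom C A B" "S \<in> coker_class C i" "E_simple C E S"
  shows False
proof -
  obtain d where d: "is_cokernel C i d" and dH: "d \<in> Hom C B S"
    by (rule coker_classE[OF assms(3,2)])
  note S = Hom_Obj(2)[OF dH] and B = Hom_Obj(1)[OF dH]
  obtain b where b: "b \<in> Hom C S B" using zero_object_terminal[OF assms(1) S] by blast
  have B_uniq: "x = y" if "x \<in> Hom C B T" "y \<in> Hom C B T" for x y T
    using zero_object_initial[OF assms(1) Hom_Obj(2)[OF that(1)]] that by blast
  note univ = is_cokernelD[OF d assms(2) dH]
  have "d \<cdot> b = Id C S"
    using univ(2)[OF S dH univ(1)] Comp_in_Hom[OF b dH] Id_in_Hom[OF S]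
      B_uniq[OF Comp_in_Hom[OF dH Comp_in_Hom[OF b dH]] dH] Id_Comp[OF dH] by blast
  moreover have "b \<cdot> d = Id C B" using B_uniq[OF Comp_in_Hom[OF dH b] Id_in_Hom[OF B]] .
  ultimately have "iso_arr C d" using iso_arrI[OF dH b] by blast
  then have "zero_object C S" using zero_object_isomorphic[OF assms(1) dH] by blast
  then show False using assms(4) by (simp add: E_simple_def)
qed

end

section \<open>Series and their multisets of factors\<close>

text \<open>Factors are recorded as full isomorphism classes, so that uniqueness becomes an equality
  of multisets.\<close>

inductive series_factors ::
    "('o, 'm, 'z) add_cat_scheme \<Rightarrow> ('m \<times> 'm) set \<Rightarrow> 'o \<Rightarrow> 'o set multiset \<Rightarrow> bool"
  for C E where
  zero: "zero_object C Z \<Longrightarrow> series_factors C E Z {#}"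
| step: "\<lbrakk>series_factors C E B M; g \<in> Hom C B D; admissible_monic E g;
    S \<in> coker_class C g; E_simple C E S\<rbrakk> \<Longrightarrow> series_factors C E D (add_mset (coker_class C g) M)"

lemma composition_series_factors:
  assumes "composition_series C E X n Xs i"
  shows "series_factors C E X (mset (map (\<lambda>l. coker_class C (i l)) [0..<n]))"
  using assms
proof (induction n arbitrary: X)
  case 0
  then show ?case by (auto simp: composition_series_def intro: series_factors.zero)
next
  case (Suc n)
  have "composition_series C E (Xs n) n Xs i" using Suc.prems by (simp add: composition_series_def)
  note IH = Suc.IH[OF this]
  obtain S where "i n \<in> Hom C (Xs n) X" "admissible_monic E (i n)" "cokernel_object C (i n) S"
    "E_simple C E S"
    using Suc.prems by (auto simp: composition_series_def)
  then show ?case using series_factors.step[OF IH] by (simp add: coker_class_def)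
qed

context exact_category
begin

text \<open>Only the last arrow has to be changed: composing it with \<open>\<phi>\<close> keeps its
  cokernel class, so a case distinction replaces induction.\<close>

lemma series_factors_isomorphic:
  assumes "series_factors C E X M" "\<phi> \<in> Hom C X Y" "iso_arr C \<phi>"
  shows "series_factors C E Y M"
  using assms(1)
proof cases
  case zero
  then show ?thesis using zero_object_isomorphic[OF _ assms(2,3)] by (simp add: series_factors.zero)
next
  case (step B N g S)
  have "coker_class C (\<phi> \<cdot> g) = coker_class C g" by (rule coker_class_iso_Comp[OF step(3) assms(2,3)])
  then show ?thesis
    using series_factors.step[OF step(2) Comp_in_Hom[OF step(3) assms(2)]
        admissible_monic_iso_Comp[OF step(4,3) assms(2,3)]] step by simp
qed

end

section \<open>Exchange and uniqueness\<close>

context AIS_category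
begin

text \<open>No series of \<open>Y\<close> is assumed; it is constructed. The induction generalises
  over \<open>Y\<close>, \<open>j\<close> and \<open>S\<close> because its hypothesis is applied to
  \<open>i\<close> from \<open>A\<close> to \<open>B\<close> in place of \<open>j\<close>.\<close>

lemma series_factors_exchange:
  assumes "series_factors C E X M" "j \<in> Hom C Y X" "admissible_monic E j"
    "S \<in> coker_class C j" "E_simple C E S"
  shows "\<exists>N. series_factors C E Y N \<and> M = add_mset (coker_class C j) N"
  using assms
proof (induction arbitrary: Y j S rule: series_factors.induct)
  case (zero Z)
  then show ?case using zero_object_no_simple_cokernel by blast
next
  case (step B M g D S')
  note g = step.hyps(2,3) and gS = step.hyps(4,5) and j = step.prems(1,2) and jS = step.prems(3,4)
  obtain i f where pb: "is_pullback C g j i f" and i: "admissible_monic E i"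
    and f: "admissible_monic E f"
    and sum: "\<And>l k u. \<lbrakk>is_pushout C i f l k; u \<in> Hom C (Cod C l) (Cod C g); u \<cdot> l = g; u \<cdot> k = j\<rbrakk>
      \<Longrightarrow> admissible_monic E u"
    using AIS[OF j(2) g(2)] HomD[OF g(1)] HomD[OF j(1)] by auto
  define A where "A = Dom C i"
  have iH: "i \<in> Hom C A B" and fH: "f \<in> Hom C A Y" and sq: "g \<cdot> i = j \<cdot> f"
    using pb HomD[OF g(1)] HomD[OF j(1)] by (auto simp: is_pullback_def A_def Hom_def)
  \<comment> \<open>(AIS) speaks of any given push-out of \<open>i\<close> and \<open>f\<close>; the
    exact structure provides one, with \<open>k\<close> admissible. Its vertex \<open>P\<close> is
    the sum of \<open>B\<close> and \<open>Y\<close>.\<close>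
  obtain l k where po: "is_pushout C i f l k" and k: "admissible_monic E k"
    using admissible_monic_pushout[OF i, of f] HomD[OF fH] HomD[OF iH] by metis
  define P where "P = Cod C l"
  have lH: "l \<in> Hom C B P" and kH: "k \<in> Hom C Y P"
    using po HomD[OF iH] HomD[OF fH] by (auto simp: is_pushout_def P_def Hom_def)
  obtain u where uH: "u \<in> Hom C P D" and ul: "u \<cdot> l = g" and uk: "u \<cdot> k = j"
    using po Hom_Obj(2)[OF g(1)] g(1) j(1) sq
    unfolding is_pushout_def P_def HomD[OF iH] HomD[OF fH] by blast
  have u: "admissible_monic E u" using sum[OF po _ ul uk] uH HomD[OF g(1)] P_def by simp
  have cl: "coker_class C f = coker_class C l" by (rule coker_class_pushout[OF po])
  have ck: "coker_class C i = coker_class C k" by (rule coker_class_pushout[OF is_pushout_sym[OF po]])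
  consider "iso_arr C k" | "iso_arr C u"
    using simple_cokernel_maximal[OF k kH u uH, of S] uk jS by blast
  then show ?case
  proof cases
    case 1
    \<comment> \<open>Case \<open>P = Y\<close>: the cokernels of \<open>i\<close> are those of the
      isomorphism \<open>k\<close>, hence zero, and \<open>A = B\<close>.\<close>
    obtain W where W: "W \<in> coker_class C i" by (rule admissible_monicE[OF i iH])
    then have "zero_object C W" using zero_cokernel_if_iso[OF kH 1] ck by simp
    then have iso_i: "iso_arr C i" by (rule iso_if_zero_cokernel[OF i iH W])
    have cg: "coker_class C (j \<cdot> f) = coker_class C g"
      using coker_class_Comp_iso[OF g(1) iH iso_i] sq by simp
    \<comment> \<open>The composite \<open>j \<cdot> f\<close> has the simple cokernel of
      \<open>g\<close>, so \<open>f\<close> or \<open>j\<close> is an isomorphism; \<open>j\<close>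
      is excluded by its own simple cokernel. Thus \<open>B\<close> and \<open>Y\<close> are
      isomorphic, and the series of \<open>B\<close> can be reused.\<close>
    have iso_f: "iso_arr C f"
      using simple_cokernel_maximal[OF f fH j(2,1), of S'] cg gS
        not_iso_if_simple_cokernel[OF j(1) jS] by blast
    obtain i' where i': "i' \<in> Hom C B A" "iso_arr C i'" by (rule iso_arr_inverse[OF iH iso_i])
    have "series_factors C E Y M"
      by (rule series_factors_isomorphic[OF step.hyps(1) Comp_in_Hom[OF i'(1) fH]
            iso_arr_Comp[OF i' fH iso_f]])
    moreover have "coker_class C j = coker_class C g"
      using coker_class_Comp_iso[OF j(1) fH iso_f] cg by simp
    ultimately show ?thesis by auto
  next
    case 2
    \<comment> \<open>Case \<open>P = X\<close>: up to the isomorphism \<open>u\<close>, the arrows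
      \<open>k\<close> and \<open>l\<close> are \<open>j\<close> and \<open>g\<close>, so the
      quotients agree crosswise.\<close>
    have ci: "coker_class C i = coker_class C j"
      using coker_class_iso_Comp[OF kH uH 2] uk ck by simp
    have cf: "coker_class C f = coker_class C g"
      using coker_class_iso_Comp[OF lH uH 2] ul cl by simp
    obtain N where N: "series_factors C E A N" "M = add_mset (coker_class C i) N"
      using step.IH[OF iH i, of S] ci jS by auto
    \<comment> \<open>Appending \<open>f\<close> to the series of \<open>A\<close> gives the series
      of \<open>Y\<close>; passing through \<open>Y\<close> instead of \<open>B\<close> merely swaps
      the last two factors.\<close>
    have "series_factors C E Y (add_mset (coker_class C f) N)"
      using series_factors.step[OF N(1) fH f, of S'] cf gS by simp
    then show ?thesis using N(2) ci cf by (auto simp: add_mset_commute)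
  qed
qed

text \<open>Induction on the series for \<open>N\<close>. Exchange applied to the series for
  \<open>M\<close>, with the last arrow \<open>g\<close> of the other one, removes the class of
  \<open>g\<close> from \<open>M\<close> and leaves a series of \<open>B\<close>, which the
  induction hypothesis compares.\<close>

lemma series_factors_unique:
  assumes "series_factors C E X M" "series_factors C E X N"
  shows "M = N"
  using assms(2,1)
proof (induction arbitrary: M rule: series_factors.induct)
  case (zero Z)
  from zero.prems show ?case
    by cases (use zero.hyps zero_object_no_simple_cokernel in blast)+
next
  case (step B N g D S)
  then show ?case using series_factors_exchange[OF step.prems step.hyps(2-5)] by blast
qed

end

text \<open>Equal multisets of cokernel classes are turned back into a permutation of indices;
  objects lying in a common class are isomorphic.\<close>

theorem theorem6p2:
  fixes C :: "('o, 'm, 'z) add_cat_scheme"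
    and E :: "('m \<times> 'm) set"
    and X :: 'o
    and m n :: nat
    and Xs Xs' :: "nat \<Rightarrow> 'o"
    and i i' :: "nat \<Rightarrow> 'm"
  assumes "AIS_category C E"
    and "X \<in> Obj C" and "finite_object C E X"
    and "composition_series C E X m Xs i"
    and "composition_series C E X n Xs' i'"
  shows "m = n \<and>
    (\<exists>\<sigma>. \<sigma> permutes {..<m} \<and>
      (\<forall>l<m. \<forall>Q Q'. cokernel_object C (i (\<sigma> l)) Q \<longrightarrow> cokernel_object C (i' l) Q' \<longrightarrow>
        isomorphic C Q' Q))"
proof -
  interpret AIS_category C E by fact
  let ?xs = "map (\<lambda>l. coker_class C (i l)) [0..<m]"
  let ?ys = "map (\<lambda>l. coker_class C (i' l)) [0..<n]"
  \<comment> \<open>This orientation makes \<open>\<sigma>\<close> act on the indices of the first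
    series: entry \<open>l\<close> of \<open>?ys\<close> is entry \<open>\<sigma> l\<close> of
    \<open>?xs\<close>.\<close>
  have eq: "mset ?ys = mset ?xs"
    by (rule series_factors_unique[OF composition_series_factors[OF assms(5)]
          composition_series_factors[OF assms(4)]])
  then have mn: "m = n" using mset_eq_length by fastforce
  obtain \<sigma> where \<sigma>: "\<sigma> permutes {..<length ?xs}" "permute_list \<sigma> ?xs = ?ys"
    by (rule mset_eq_permutation[OF eq])
  have "isomorphic C Q' Q"
    if l: "l < m" and Q: "cokernel_object C (i (\<sigma> l)) Q" "cokernel_object C (i' l) Q'" for l Q Q'
  proof -
    have "\<sigma> l < m" using permutes_in_image[OF \<sigma>(1), of l] l by simp
    then have "?ys ! l = coker_class C (i (\<sigma> l))"
      using permute_list_nth[OF \<sigma>(1), of l] \<sigma>(2) l by simp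
    then have "coker_class C (i' l) = coker_class C (i (\<sigma> l))" using l mn by simp
    then have "Q' \<in> coker_class C (i' l)" "Q \<in> coker_class C (i' l)"
      using Q by (auto simp: coker_class_def)
    then show ?thesis using coker_class_isomorphic unfolding isomorphic_def by metis
  qed
  then show ?thesis using mn \<sigma>(1) by auto
qed

end
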